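(* Let $n\ge 1$, let $Q^n=[0,\infty)^n$ and let $\Phi:Q^n\to[0,\infty)$ be a function. For metric spaces $(X_i,d_i)$, $i=1,\dots,n$, put $X=\prod_{i=1}^n X_i$ and $$d_\Phi\big((x_1,\dots,x_n),(y_1,\dots,y_n)\big)=\Phi\big(d_1(x_1,y_1),\dots,d_n(x_n,y_n)\big).$$ Then $(X,d_\Phi)$ is an inner metric space for all possible choices of inner metric spaces $(X_i,d_i)$, $i=1,\dots,n$, if and only if the function $$\Psi:\mathbb{R}^n\to[0,\infty),\qquad \Psi\Big(\sum_{i=1}^n x_ie_i\Big):=\Phi\Big(\sum_{i=1}^n|x_i|e_i\Big)$$ is a norm on $\mathbb{R}^n$.
   Context: $e_1,\dots,e_n$ is the standard basis of $\mathbb{R}^n$. For a metric space $(X,d)$ and a continuous path $c:[0,1]\to X$, the length is $L(c):=\sup\big\{\sum_{j=1}^k d(c(t_{j-1}),c(t_j))\big\}$, the supremum over all subdivisions $0=t_0\le t_1\le\dots\le t_k=1$. A metric space $(X,d)$ is called an inner metric space if for all $x,y\in X$ one has $d(x,y)=\inf L(c)$, the infimum over all continuous paths $c$ in $X$ from $x$ to $y$. (The assertion that $(X,d_\Phi)$ is an inner metric space includes the assertion that $d_\Phi$ is a metric.) *)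

theory Defs
  imports "HOL-Analysis.Analysis"
begin

(* Values of c outside {0..1} are irrelevant. The length may be infinite, hence ereal. *)
definition path_length :: "('a \<Rightarrow> 'a \<Rightarrow> real) \<Rightarrow> (real \<Rightarrow> 'a) \<Rightarrow> ereal" where
  "path_length d c =
     (SUP (k, t) \<in> {(k :: nat, t :: nat \<Rightarrow> real). t 0 = 0 \<and> t k = 1 \<and> (\<forall>j<k. t j \<le> t (Suc j))}.
        ereal (\<Sum>j=1..k. d (c (t (j - 1))) (c (t j))))"

(* The infimum over the empty set is infinity, so points of an inner metric space
   are always joined by a path (of finite length). *)
definition inner_metric_space :: "'a set \<Rightarrow> ('a \<Rightarrow> 'a \<Rightarrow> real) \<Rightarrow> bool" where
  "inner_metric_space M d \<longleftrightarrow> Metric_space M d \<and>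
     (\<forall>x\<in>M. \<forall>y\<in>M. ereal (d x y) =
        (INF c \<in> {c. pathin (Metric_space.mtopology M d) c \<and> c 0 = x \<and> c 1 = y}. path_length d c))"

definition nonneg_orthant :: "(real ^ 'n) set" where
  "nonneg_orthant = {x. \<forall>i. 0 \<le> x $ i}"

(* A point of the product is a function on the finite index type 'n; the factors are carrier
   sets in one common type 'a. HOL cannot quantify over types inside a formula, so "all inner
   metric spaces" is rendered as all carriers in an arbitrary type 'a with at least as many
   elements as the reals. Any family of n metric spaces is, up to isometry, of this form for
   some such 'a (e.g. a sum type), and a type that is too small, such as unit, would not even
   contain an interval. *)
definition product_dist ::
  "(real ^ 'n \<Rightarrow> real) \<Rightarrow> ('n \<Rightarrow> 'a \<Rightarrow> 'a \<Rightarrow> real) \<Rightarrow> ('n \<Rightarrow> 'a) \<Rightarrow> ('n \<Rightarrow> 'a) \<Rightarrow> real" where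
  "product_dist \<Phi> d x y = \<Phi> (\<chi> i. d i (x i) (y i))"

definition even_extension :: "(real ^ 'n \<Rightarrow> real) \<Rightarrow> real ^ 'n \<Rightarrow> real" where
  "even_extension \<Phi> x = \<Phi> (\<chi> i. \<bar>x $ i\<bar>)"

definition is_norm :: "('v::real_vector \<Rightarrow> real) \<Rightarrow> bool" where
  "is_norm N \<longleftrightarrow> (\<forall>x. 0 \<le> N x) \<and> (\<forall>x. N x = 0 \<longleftrightarrow> x = 0) \<and>
     (\<forall>a x. N (a *\<^sub>R x) = \<bar>a\<bar> * N x) \<and> (\<forall>x y. N (x + y) \<le> N x + N y)"

end

(* Points of an inner metric space at distance less than L are joined by an L-Lipschitz path, by
   reparametrizing with arc length. If Psi is a norm, then Phi is monotone, so the path made of such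
   paths in the factors is Lipschitz with constant Phi(L_1, ..., L_n), which is arbitrarily close to
   the distance of the endpoints.

   Conversely, isosceles triangles in the plane give Phi a <= 2 Phi b for a <= 2 b, so that paths for
   d_Phi in R^n are continuous in the usual sense. Taking one-point spaces for all factors but one
   makes Psi linear on each half-axis, hence comparable with the Euclidean norm. Finally
   M x = sup {Psi(t x) / t | t > 0} is homogeneous, and it is approximated by Psi near 0 uniformly in
   the direction; cutting an almost shortest path from 0 to x into short pieces gives M x <= Psi x. *)
theory Submission
  imports Defs
begin

subsection \<open>Paths in inner metric spaces\<close>

lemma pathin_mtopology_iff:
  assumes "Metric_space M d"
  shows "pathin (Metric_space.mtopology M d) c \<longleftrightarrow>
    (\<forall>s\<in>{0..1}. c s \<in> M) \<and>
    (\<forall>s\<in>{0..1}. \<forall>\<epsilon>>0. \<exists>\<delta>>0. \<forall>t\<in>{0..1}. \<bar>t - s\<bar> < \<delta> \<longrightarrow> d (c s) (c t) < \<epsilon>)"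
    (is "?lhs \<longleftrightarrow> ?rhs")
proof -
  interpret Metric_space M d by fact
  show ?thesis
  proof
    assume L: ?lhs
    then have M: "\<forall>s\<in>{0..1}. c s \<in> M"
      using continuous_map_image_subset_topspace[of "top_of_set {0..1}" mtopology c]
      unfolding pathin_def by auto
    have "\<exists>\<delta>>0. \<forall>t\<in>{0..1}. \<bar>t - s\<bar> < \<delta> \<longrightarrow> d (c s) (c t) < \<epsilon>"
      if s: "s \<in> {0..1}" and e: "\<epsilon> > 0" for s \<epsilon>
    proof -
      obtain U where "openin (top_of_set {0..1}) U" "s \<in> U" and U: "\<forall>y\<in>U. c y \<in> mball (c s) \<epsilon>"
        using L s e unfolding pathin_def continuous_map_to_metric topspace_subtopology_subset
        by (metis (no_types) Int_UNIV_left topspace_euclidean topspace_subtopology)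
      then obtain \<delta> where "\<delta> > 0" "ball s \<delta> \<inter> {0..1} \<subseteq> U"
        unfolding openin_contains_ball by blast
      then show ?thesis
        using U by (intro exI[of _ \<delta>]) (auto simp: dist_real_def subset_iff)
    qed
    with M show ?rhs by blast
  next
    assume R: ?rhs
    show ?lhs
      unfolding pathin_def continuous_map_to_metric
    proof (intro ballI allI impI)
      fix s \<epsilon> :: real
      assume "s \<in> topspace (top_of_set {0..1})" "\<epsilon> > 0"
      then have s: "s \<in> {0..1}" by simp
      with R \<open>\<epsilon> > 0\<close> obtain \<delta> where "\<delta> > 0"
        "\<forall>t\<in>{0..1}. \<bar>t - s\<bar> < \<delta> \<longrightarrow> d (c s) (c t) < \<epsilon>"
        by blast
      then show "\<exists>U. openin (top_of_set {0..1}) U \<and> s \<in> U \<and> (\<forall>y\<in>U. c y \<in> mball (c s) \<epsilon>)"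
        using R s by (intro exI[of _ "{0..1} \<inter> ball s \<delta>"])
          (auto simp: openin_open_Int dist_real_def abs_minus_commute[of s])
    qed
  qed
qed

section \<open>Lengths of paths and Lipschitz bounds\<close>

lemma path_length_ge_sum:
  assumes "t 0 = 0" "t k = 1" "\<And>j. j < k \<Longrightarrow> t j \<le> t (Suc j)"
  shows "ereal (\<Sum>j=1..k. d (c (t (j - 1))) (c (t j))) \<le> path_length d c"
  unfolding path_length_def using assms by (intro SUP_upper2[of "(k, t)"]) auto

lemma path_length_ge_dist: "ereal (d (c 0) (c 1)) \<le> path_length d c"
  using path_length_ge_sum[of real 1 d c] by simp

lemma chain_mono:
  fixes t :: "nat \<Rightarrow> real"
  assumes "\<And>j. j < k \<Longrightarrow> t j \<le> t (Suc j)" "i \<le> j" "j \<le> k"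
  shows "t i \<le> t j"
  using assms(2,3)
proof (induction rule: dec_induct)
  case (step n)
  then show ?case using assms(1)[of n] by simp
qed simp

text \<open>Over any subdivision the bounds \<open>L * (t j - t (j - 1))\<close> telescope to
  \<open>L\<close>.\<close>

lemma path_length_le_Lipschitz:
  assumes "\<And>s t. 0 \<le> s \<Longrightarrow> s \<le> t \<Longrightarrow> t \<le> 1 \<Longrightarrow> d (c s) (c t) \<le> L * (t - s)"
  shows "path_length d c \<le> ereal L"
  unfolding path_length_def
proof (rule SUP_least, clarsimp)
  fix k and t :: "nat \<Rightarrow> real"
  assume t: "t 0 = 0" "t k = 1" "\<forall>j<k. t j \<le> t (Suc j)"
  have "(\<Sum>j=Suc 0..k. d (c (t (j - Suc 0))) (c (t j))) \<le> (\<Sum>j=Suc 0..k. L * t j - L * t (j - 1))"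
  proof (rule sum_mono)
    fix j assume "j \<in> {Suc 0..k}"
    moreover from this have "0 \<le> t (j - 1)" "t (j - 1) \<le> t j" "t j \<le> 1"
      using chain_mono[of k t 0 "j - 1"] chain_mono[of k t j k] chain_mono[of k t "j - 1" j] t by auto
    ultimately show "d (c (t (j - Suc 0))) (c (t j)) \<le> L * t j - L * t (j - 1)"
      using assms by (simp add: right_diff_distrib)
  qed
  also have "\<dots> = L"
    using sum_telescope''[of 0 k "\<lambda>j. L * t j"] t by simp
  finally show "(\<Sum>j=Suc 0..k. d (c (t (j - Suc 0))) (c (t j))) \<le> L" .
qed

text \<open>A path with Lipschitz constant \<open>L\<close> on the unit interval has length at most
  \<open>L\<close>, and \<open>L\<close> may be taken arbitrarily close to \<open>d x y\<close>.
  Conversely, the subdivision with a single step shows that no path is shorter than the distance of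
  its endpoints.\<close>

lemma inner_metric_spaceI:
  assumes "Metric_space M d"
    and ex: "\<And>x y L. x \<in> M \<Longrightarrow> y \<in> M \<Longrightarrow> d x y < L \<Longrightarrow>
      \<exists>c. (\<forall>s\<in>{0..1}. c s \<in> M) \<and> c 0 = x \<and> c 1 = y \<and>
        (\<forall>s t. 0 \<le> s \<longrightarrow> s \<le> t \<longrightarrow> t \<le> 1 \<longrightarrow> d (c s) (c t) \<le> L * (t - s))"
  shows "inner_metric_space M d"
  unfolding inner_metric_space_def
proof (intro conjI ballI)
  interpret Metric_space M d by fact
  fix x y assume xy: "x \<in> M" "y \<in> M"
  let ?P = "{c. pathin mtopology c \<and> c 0 = x \<and> c 1 = y}"
  show "ereal (d x y) = (INF c\<in>?P. path_length d c)"
  proof (rule antisym)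
    show "ereal (d x y) \<le> (INF c\<in>?P. path_length d c)"
      by (rule INF_greatest) (use path_length_ge_dist[of d] in auto)
    show "(INF c\<in>?P. path_length d c) \<le> ereal (d x y)"
    proof (rule ereal_le_epsilon2)
      fix e :: real assume "e > 0"
      define L where "L = d x y + e"
      have L: "d x y < L" "0 < L"
        using \<open>e > 0\<close> nonneg[of x y] by (auto simp: L_def simp del: nonneg)
      then obtain c where c: "\<forall>s\<in>{0..1}. c s \<in> M" "c 0 = x" "c 1 = y"
        "\<And>s t. 0 \<le> s \<Longrightarrow> s \<le> t \<Longrightarrow> t \<le> 1 \<Longrightarrow> d (c s) (c t) \<le> L * (t - s)"
        using ex[OF xy] by blast
      have lip: "d (c s) (c t) \<le> L * \<bar>t - s\<bar>" if "s \<in> {0..1}" "t \<in> {0..1}" for s t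
        using that c(4)[of s t] c(4)[of t s] by (cases "s \<le> t") (auto simp: commute)
      have "pathin mtopology c"
        unfolding pathin_mtopology_iff[OF assms(1)]
      proof (intro conjI ballI allI impI)
        fix s \<epsilon> :: real assume "s \<in> {0..1}" "\<epsilon> > 0"
        then show "\<exists>\<delta>>0. \<forall>t\<in>{0..1}. \<bar>t - s\<bar> < \<delta> \<longrightarrow> d (c s) (c t) < \<epsilon>"
          using L lip by (intro exI[of _ "\<epsilon> / L"])
            (auto simp: field_simps intro!: le_less_trans[OF lip])
      qed (use c in auto)
      then have "(INF c\<in>?P. path_length d c) \<le> path_length d c"
        using c by (intro INF_lower) auto
      also have "\<dots> \<le> ereal L"
        by (rule path_length_le_Lipschitz) (use c(4) in auto)
      finally show "(INF c\<in>?P. path_length d c) \<le> ereal (d x y) + ereal e"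
        by (simp add: L_def)
    qed
  qed
qed fact

text \<open>The new parameter runs through the values of \<open>\<sigma>\<close>; taking the supremum of a sublevel set
  makes sense even where \<open>\<sigma>\<close> jumps, so the continuity of arc length is never needed.\<close>

lemma reparametrize_Lipschitz:
  fixes \<sigma> :: "real \<Rightarrow> real"
  assumes "Metric_space M d" and path: "pathin (Metric_space.mtopology M d) c"
    and \<sigma>: "\<And>s t. 0 \<le> s \<Longrightarrow> s \<le> t \<Longrightarrow> t \<le> 1 \<Longrightarrow> d (c s) (c t) \<le> \<sigma> t - \<sigma> s"
  obtains b where "\<forall>s\<in>{0..1}. b s \<in> M" "b 0 = c 0" "b 1 = c 1"
    "\<And>s t. 0 \<le> s \<Longrightarrow> s \<le> t \<Longrightarrow> t \<le> 1 \<Longrightarrow> d (b s) (b t) \<le> (\<sigma> 1 - \<sigma> 0) * (t - s)"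
proof -
  interpret Metric_space M d by fact
  note path = path[unfolded pathin_mtopology_iff[OF assms(1)]]
  have cont: "\<exists>\<delta>>0. \<forall>t\<in>{0..1}. \<bar>t - s\<bar> < \<delta> \<longrightarrow> d (c s) (c t) < e"
    if "s \<in> {0..1}" "e > 0" for s e
    using path that by blast
  have cM: "c s \<in> M" if "s \<in> {0..1}" for s
    using path that by blast
  define A where "A u = {t \<in> {0..1}. \<sigma> t \<le> u}" for u
  define \<tau> where "\<tau> u = Sup (A u)" for u
  have \<sigma>_mono: "\<sigma> s \<le> \<sigma> t" if "0 \<le> s" "s \<le> t" "t \<le> 1" for s t
    using \<sigma>[OF that] nonneg[of "c s" "c t"] by linarith
  have bdd: "bdd_above (A u)" for u
    by (rule bdd_aboveI[of _ 1]) (auto simp: A_def)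
  have ne: "0 \<in> A u" if "\<sigma> 0 \<le> u" for u
    using that by (auto simp: A_def)
  have \<tau>_upper: "t \<le> \<tau> u" if "t \<in> A u" for t u
    unfolding \<tau>_def using cSup_upper[OF that bdd] .
  have \<tau>_bounds: "\<tau> u \<in> {0..1}" if "\<sigma> 0 \<le> u" for u
  proof -
    have "\<tau> u \<le> 1"
      unfolding \<tau>_def using ne[OF that] by (intro cSup_least) (blast, auto simp: A_def)
    then show ?thesis using \<tau>_upper[OF ne[OF that]] by simp
  qed
  \<comment> \<open>The supremum \<open>\<tau> u\<close> need not lie in \<open>A u\<close>. It is
    only approached from below by parameters where \<sigma> is at most \<open>u\<close>, while
    \<sigma> exceeds \<open>u\<close> at every later parameter (\<open>above\<close>).\<close>
  have below: "\<exists>r\<in>A u. z < r \<and> r \<le> \<tau> u" if u: "\<sigma> 0 \<le> u" "z < \<tau> u" for u z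
  proof -
    have "A u \<noteq> {}" using ne[OF u(1)] by blast
    then obtain r where "r \<in> A u" "z < r"
      using less_cSupD[of "A u" z] u(2) unfolding \<tau>_def by blast
    then show ?thesis using \<tau>_upper by blast
  qed
  have above: "u < \<sigma> s" if "\<tau> u < s" "s \<le> 1" "\<sigma> 0 \<le> u" for u s
  proof (rule ccontr)
    assume "\<not> u < \<sigma> s"
    then have "s \<in> A u" using that \<tau>_bounds[of u] by (auto simp: A_def)
    then show False using \<tau>_upper[of s u] that by simp
  qed
  have main: "d (c (\<tau> u)) (c (\<tau> v)) \<le> v - u" if uv: "\<sigma> 0 \<le> u" "u \<le> v" for u v
  proof -
    have \<tau>: "\<tau> u \<in> {0..1}" "\<tau> v \<in> {0..1}"
      using uv \<tau>_bounds by auto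
    have "A u \<subseteq> A v" using uv by (auto simp: A_def)
    then have "\<tau> u \<le> \<tau> v"
      unfolding \<tau>_def using ne[OF uv(1)] bdd by (intro cSup_subset_mono) auto
    then consider "\<tau> u = \<tau> v" | "\<tau> u < \<tau> v" by linarith
    then show ?thesis
    proof cases
      case 1
      then show ?thesis using \<tau> path uv by simp
    next
      case 2
      show ?thesis
      proof (rule field_le_epsilon)
        fix e :: real assume "e > 0"
        then obtain \<delta>1 where \<delta>1: "\<delta>1 > 0"
          "\<And>t. t \<in> {0..1} \<Longrightarrow> \<bar>t - \<tau> u\<bar> < \<delta>1 \<Longrightarrow> d (c (\<tau> u)) (c t) < e / 2"
          using cont[OF \<tau>(1), of "e / 2"] by auto
        obtain \<delta>2 where \<delta>2: "\<delta>2 > 0"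
          "\<And>t. t \<in> {0..1} \<Longrightarrow> \<bar>t - \<tau> v\<bar> < \<delta>2 \<Longrightarrow> d (c (\<tau> v)) (c t) < e / 2"
          using cont[OF \<tau>(2), of "e / 2"] \<open>e > 0\<close> by auto
        \<comment> \<open>Take \<open>s\<close> just after \<open>\<tau> u\<close> and
          \<open>r\<close> just before \<open>\<tau> v\<close>; the midpoint \<open>m\<close> keeps
          \<open>s\<close> before \<open>r\<close>. Since \<open>\<sigma> s > u\<close> and
          \<open>\<sigma> r \<le> v\<close>, the stretch from \<open>s\<close> to \<open>r\<close>
          costs at most \<open>v - u\<close>, and continuity of \<open>c\<close> makes the two end
          pieces cost at most \<open>e / 2\<close> each.\<close>
        define m where "m = (\<tau> u + \<tau> v) / 2"
        define s where "s = min (\<tau> u + \<delta>1 / 2) m"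
        have s: "\<tau> u < s" "s \<le> m" "\<bar>s - \<tau> u\<bar> < \<delta>1" "m < \<tau> v" "s \<in> {0..1}"
          using \<delta>1 2 \<tau> by (auto simp: s_def m_def min_def field_simps)
        obtain r where r: "r \<in> A v" "max (\<tau> v - \<delta>2) m < r" "r \<le> \<tau> v"
          using below[of v "max (\<tau> v - \<delta>2) m"] uv s \<delta>2 by auto
        have r': "r \<in> {0..1}" "\<sigma> r \<le> v" "\<bar>r - \<tau> v\<bar> < \<delta>2"
          using r by (auto simp: A_def)
        have "d (c (\<tau> u)) (c (\<tau> v)) \<le> d (c (\<tau> u)) (c s) + d (c s) (c (\<tau> v))"
          using cM \<tau> s by (intro triangle) auto
        also have "d (c s) (c (\<tau> v)) \<le> d (c s) (c r) + d (c (\<tau> v)) (c r)"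
          using cM \<tau> s r' by (intro triangle') auto
        also have "d (c s) (c r) \<le> v - u"
          using \<sigma>[of s r] above[of u s] s r r' uv by auto
        also have "d (c (\<tau> u)) (c s) \<le> e / 2"
          using \<delta>1(2)[of s] s by simp
        also have "d (c (\<tau> v)) (c r) \<le> e / 2"
          using \<delta>2(2)[of r] r' by simp
        finally show "d (c (\<tau> u)) (c (\<tau> v)) \<le> v - u + e" by simp
      qed
    qed
  qed
  \<comment> \<open>If \<sigma> is constant on an initial interval,
    \<open>\<tau> (\<sigma> 0)\<close> is positive. But \<open>c\<close> does not move on
    \<open>A (\<sigma> 0)\<close>, and continuity carries this over to the supremum.\<close>
  have start: "c (\<tau> (\<sigma> 0)) = c 0"
  proof -
    have \<tau>: "\<tau> (\<sigma> 0) \<in> {0..1}" using \<tau>_bounds by simp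
    have "d (c (\<tau> (\<sigma> 0))) (c 0) \<le> 0"
    proof (rule field_le_epsilon)
      fix e :: real assume "e > 0"
      then obtain \<delta> where \<delta>: "\<delta> > 0"
        "\<And>t. t \<in> {0..1} \<Longrightarrow> \<bar>t - \<tau> (\<sigma> 0)\<bar> < \<delta> \<Longrightarrow> d (c (\<tau> (\<sigma> 0))) (c t) < e"
        using cont[OF \<tau>] by blast
      obtain r where r: "r \<in> A (\<sigma> 0)" "\<tau> (\<sigma> 0) - \<delta> < r" "r \<le> \<tau> (\<sigma> 0)"
        using below[of "\<sigma> 0" "\<tau> (\<sigma> 0) - \<delta>"] \<delta> by auto
      have r': "r \<in> {0..1}" "\<sigma> r \<le> \<sigma> 0"
        using r by (auto simp: A_def)
      have "d (c (\<tau> (\<sigma> 0))) (c 0) \<le> d (c (\<tau> (\<sigma> 0))) (c r) + d (c 0) (c r)"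
        using cM \<tau> r' by (intro triangle') auto
      also have "d (c 0) (c r) \<le> 0"
        using \<sigma>[of 0 r] r' by auto
      also have "d (c (\<tau> (\<sigma> 0))) (c r) \<le> e"
        using \<delta>(2)[of r] r r' by simp
      finally show "d (c (\<tau> (\<sigma> 0))) (c 0) \<le> 0 + e" by simp
    qed
    moreover have "0 \<le> d (c (\<tau> (\<sigma> 0))) (c 0)" by (rule nonneg)
    ultimately have "d (c (\<tau> (\<sigma> 0))) (c 0) = 0" by linarith
    then show ?thesis using cM \<tau> by simp
  qed
  have finish: "\<tau> (\<sigma> 1) = 1"
  proof -
    have "1 \<in> A (\<sigma> 1)" by (simp add: A_def)
    then show ?thesis
      using \<tau>_upper[of 1 "\<sigma> 1"] \<tau>_bounds[of "\<sigma> 1"] \<sigma>_mono[of 0 1] by simp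
  qed
  \<comment> \<open>The affine change of parameter from {0..1} to the interval from
    \<open>\<sigma> 0\<close> to \<open>\<sigma> 1\<close> turns the constant 1 of
    \<open>main\<close> into \<open>\<sigma> 1 - \<sigma> 0\<close>.\<close>
  define b where "b s = c (\<tau> (\<sigma> 0 + (\<sigma> 1 - \<sigma> 0) * s))" for s
  have arg: "\<sigma> 0 \<le> \<sigma> 0 + (\<sigma> 1 - \<sigma> 0) * s" if "0 \<le> s" for s
    using that \<sigma>_mono[of 0 1] by simp
  show ?thesis
  proof
    show "\<forall>s\<in>{0..1}. b s \<in> M"
      using cM \<tau>_bounds[OF arg] by (auto simp: b_def)
    show "b 0 = c 0" "b 1 = c 1"
      using start finish by (auto simp: b_def)
    fix s t :: real assume st: "0 \<le> s" "s \<le> t" "t \<le> 1"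
    then have "(\<sigma> 1 - \<sigma> 0) * s \<le> (\<sigma> 1 - \<sigma> 0) * t"
      using \<sigma>_mono[of 0 1] by (intro mult_left_mono) auto
    then show "d (b s) (b t) \<le> (\<sigma> 1 - \<sigma> 0) * (t - s)"
      using main[OF arg[OF st(1)], of "\<sigma> 0 + (\<sigma> 1 - \<sigma> 0) * t"]
      by (simp add: b_def right_diff_distrib)
  qed
qed

text \<open>Here \<sigma> is arc length: appending the point \<open>t\<close> to a subdivision that
  ends in \<open>s\<close> adds \<open>d (c s) (c t)\<close> to its sum, which is the growth
  condition of \<open>reparametrize_Lipschitz\<close>.\<close>

lemma finite_length_reparametrization:
  assumes "Metric_space M d" and path: "pathin (Metric_space.mtopology M d) c"
    and len: "path_length d c \<le> ereal L"
  obtains b where "\<forall>s\<in>{0..1}. b s \<in> M" "b 0 = c 0" "b 1 = c 1"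
    "\<And>s t. 0 \<le> s \<Longrightarrow> s \<le> t \<Longrightarrow> t \<le> 1 \<Longrightarrow> d (b s) (b t) \<le> L * (t - s)"
proof -
  interpret Metric_space M d by fact
  define S where "S k p = (\<Sum>j=1..k. d (c (p (j - 1))) (c (p j)))" for k and p :: "nat \<Rightarrow> real"
  \<comment> \<open>\<open>Q t\<close> consists of the subdivisions of the interval from 0 to
    \<open>t\<close>, so \<open>\<sigma> t\<close> is the length of \<open>c\<close> up to time
    \<open>t\<close>. For \<open>t\<close> in {0..1} this is a genuine real supremum: every such
    subdivision extends to one ending in 1, so its sum is at most \<open>L\<close>.\<close>
  define Q where "Q t = {(k, p). p 0 = 0 \<and> p k = t \<and> (\<forall>j<k. p j \<le> p (Suc j))}"
    for t :: real
  define \<sigma> where "\<sigma> t = (SUP (k, p) \<in> Q t. S k p)" for t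
  have extend: "(Suc k, \<lambda>j. if j \<le> k then p j else t) \<in> Q t"
      "S (Suc k) (\<lambda>j. if j \<le> k then p j else t) = S k p + d (c s) (c t)"
    if "(k, p) \<in> Q s" "s \<le> t" for k p s t
  proof -
    show "(Suc k, \<lambda>j. if j \<le> k then p j else t) \<in> Q t"
      using that by (auto simp: Q_def le_Suc_eq less_Suc_eq)
    have "S k (\<lambda>j. if j \<le> k then p j else t) = S k p"
      unfolding S_def by (intro sum.cong) auto
    then show "S (Suc k) (\<lambda>j. if j \<le> k then p j else t) = S k p + d (c s) (c t)"
      using that by (auto simp: S_def Q_def)
  qed
  have S1: "S k p \<le> L" if "(k, p) \<in> Q 1" for k p
  proof -
    have "ereal (S k p) \<le> path_length d c"
      unfolding S_def using that by (intro path_length_ge_sum) (auto simp: Q_def)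
    also note len
    finally show ?thesis by simp
  qed
  have S_le: "S k p \<le> L" if "(k, p) \<in> Q t" "t \<le> 1" for k p t
    using S1[OF extend(1)[OF that]] extend(2)[OF that] nonneg[of "c t" "c 1"] by linarith
  have bdd: "bdd_above ((\<lambda>(k, p). S k p) ` Q t)" if "t \<le> 1" for t
    using S_le that by (intro bdd_aboveI[of _ L]) auto
  have Q_ne: "(1, \<lambda>j. if j = 0 then 0 else t) \<in> Q t" if "0 \<le> t" for t
    using that by (auto simp: Q_def)
  have S_upper: "S k p \<le> \<sigma> t" if "(k, p) \<in> Q t" "t \<le> 1" for k p t
    unfolding \<sigma>_def using cSUP_upper[OF that(1) bdd[OF that(2)]] by simp
  have \<sigma>: "d (c s) (c t) \<le> \<sigma> t - \<sigma> s" if "0 \<le> s" "s \<le> t" "t \<le> 1" for s t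
  proof -
    have "\<sigma> s \<le> \<sigma> t - d (c s) (c t)"
      unfolding \<sigma>_def[of s]
    proof (rule cSUP_least)
      show "Q s \<noteq> {}" using Q_ne[OF that(1)] by blast
      fix x assume "x \<in> Q s"
      then obtain k p where x: "x = (k, p)" "(k, p) \<in> Q s" by (cases x) auto
      then have "S k p + d (c s) (c t) \<le> \<sigma> t"
        using S_upper[OF extend(1)[OF x(2) that(2)] that(3)] extend(2)[OF x(2) that(2)] by simp
      then show "(case x of (k, p) \<Rightarrow> S k p) \<le> \<sigma> t - d (c s) (c t)"
        using x by simp
    qed
    then show ?thesis by simp
  qed
  have "0 \<le> S 1 (\<lambda>j. if j = 0 then 0 else 0)"
    by (simp add: S_def)
  then have "0 \<le> \<sigma> 0"
    using S_upper[OF Q_ne[of 0]] by simp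
  moreover have "\<sigma> 1 \<le> L"
    unfolding \<sigma>_def using Q_ne[of 1] S1 by (intro cSUP_least) auto
  ultimately have le: "\<sigma> 1 - \<sigma> 0 \<le> L" by simp
  obtain b where b: "\<forall>s\<in>{0..1}. b s \<in> M" "b 0 = c 0" "b 1 = c 1"
    "\<And>s t. 0 \<le> s \<Longrightarrow> s \<le> t \<Longrightarrow> t \<le> 1 \<Longrightarrow> d (b s) (b t) \<le> (\<sigma> 1 - \<sigma> 0) * (t - s)"
    using reparametrize_Lipschitz[OF assms(1) path \<sigma>] by blast
  have "d (b s) (b t) \<le> L * (t - s)" if "0 \<le> s" "s \<le> t" "t \<le> 1" for s t
    using b(4)[OF that] mult_right_mono[OF le, of "t - s"] that by simp
  with b that show thesis by blast
qed

lemma inner_metric_space_Lipschitz_path: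
  assumes inner: "inner_metric_space M d" and "x \<in> M" "y \<in> M" "d x y < L"
  obtains b where "\<forall>s\<in>{0..1}. b s \<in> M" "b 0 = x" "b 1 = y"
    "\<And>s t. 0 \<le> s \<Longrightarrow> s \<le> t \<Longrightarrow> t \<le> 1 \<Longrightarrow> d (b s) (b t) \<le> L * (t - s)"
proof -
  have M: "Metric_space M d"
    using inner by (simp add: inner_metric_space_def)
  have "(INF c \<in> {c. pathin (Metric_space.mtopology M d) c \<and> c 0 = x \<and> c 1 = y}. path_length d c)
      < ereal L"
  proof -
    have "ereal (d x y) = (INF c \<in> {c. pathin (Metric_space.mtopology M d) c \<and> c 0 = x \<and> c 1 = y}.
        path_length d c)"
      using inner assms(2,3) unfolding inner_metric_space_def by blast
    then show ?thesis using assms(4) by (metis less_ereal.simps(1))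
  qed
  then obtain c where "pathin (Metric_space.mtopology M d) c" "c 0 = x" "c 1 = y"
    "path_length d c < ereal L"
    by (auto simp: INF_less_iff)
  then show thesis
    using finite_length_reparametrization[OF M, of c L] that by (metis less_imp_le)
qed

text \<open>Supplies the test spaces for the converse: convex sets copied into the type
  \<open>'a\<close>, with straight segments as shortest paths.\<close>

lemma inner_metric_space_convex_image:
  fixes g :: "'b::real_normed_vector \<Rightarrow> 'a"
  assumes "inj g" "convex S"
  shows "inner_metric_space (g ` S) (\<lambda>x y. dist (inv g x) (inv g y))"
proof (rule inner_metric_spaceI)
  show "Metric_space (g ` S) (\<lambda>x y. dist (inv g x) (inv g y))"
    using assms(1) by unfold_locales (auto simp: dist_commute dist_triangle inj_eq)
  fix x y L assume xy: "x \<in> g ` S" "y \<in> g ` S" and L: "dist (inv g x) (inv g y) < L"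
  then obtain p q where pq: "x = g p" "y = g q" "p \<in> S" "q \<in> S" by auto
  define c where "c s = g ((1 - s) *\<^sub>R p + s *\<^sub>R q)" for s
  have "dist (inv g (c s)) (inv g (c t)) \<le> L * (t - s)" if "s \<le> t" for s t
  proof -
    have "((1 - s) *\<^sub>R p + s *\<^sub>R q) - ((1 - t) *\<^sub>R p + t *\<^sub>R q) = (t - s) *\<^sub>R (p - q)"
      by (simp add: algebra_simps)
    then have "dist (inv g (c s)) (inv g (c t)) = (t - s) * dist p q"
      using assms(1) that by (simp add: c_def dist_norm)
    also have "\<dots> \<le> (t - s) * L"
      using L that assms(1) pq by (intro mult_left_mono) auto
    finally show ?thesis by (simp add: mult.commute)
  qed
  moreover have "c s \<in> g ` S" if "s \<in> {0..1}" for s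
    using that pq assms(2) unfolding c_def convex_alt by auto
  ultimately show "\<exists>c. (\<forall>s\<in>{0..1}. c s \<in> g ` S) \<and> c 0 = x \<and> c 1 = y \<and>
      (\<forall>s t. 0 \<le> s \<longrightarrow> s \<le> t \<longrightarrow> t \<le> 1 \<longrightarrow> dist (inv g (c s)) (inv g (c t)) \<le> L * (t - s))"
    using pq by (intro exI[of _ c]) (auto simp: c_def)
qed

subsection \<open>Products with respect to a norm\<close>

lemma even_extension_eq:
  assumes "\<And>i. 0 \<le> x $ i"
  shows "even_extension \<Phi> x = \<Phi> x"
proof -
  have "(\<chi> i. \<bar>x $ i\<bar>) = x" using assms by (simp add: vec_eq_iff)
  then show ?thesis by (simp add: even_extension_def)
qed

text \<open>Lowering a coordinate gives a convex combination of the vector and its mirror image, on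
  which the extension takes the same value.\<close>

lemma even_norm_lower_coordinate:
  fixes \<Phi> :: "real ^ 'n \<Rightarrow> real"
  assumes norm: "is_norm (even_extension \<Phi>)" and a: "0 \<le> a" "a \<le> y $ k"
  shows "even_extension \<Phi> (\<chi> i. if i = k then a else y $ i) \<le> even_extension \<Phi> y"
proof -
  let ?N = "even_extension \<Phi>"
  define y' where "y' = (\<chi> i. if i = k then - y $ k else y $ i)"
  \<comment> \<open>The weight solves \<open>r * y $ k - (1 - r) * y $ k = a\<close>. If
    \<open>y $ k = 0\<close>, then \<open>a = 0\<close> and \<open>y' = y\<close>, so any weight
    would do.\<close>
  define r where "r = (if y $ k = 0 then 1 else (1 + a / y $ k) / 2)"
  have r: "0 \<le> r" "r \<le> 1"
    using a by (auto simp: r_def divide_le_eq)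
  have "(\<chi> i. \<bar>y' $ i\<bar>) = (\<chi> i. \<bar>y $ i\<bar>)"
    by (simp add: vec_eq_iff y'_def)
  then have y': "?N y' = ?N y"
    by (simp add: even_extension_def)
  have "(\<chi> i. if i = k then a else y $ i) = r *\<^sub>R y + (1 - r) *\<^sub>R y'"
    using a by (auto simp: vec_eq_iff y'_def r_def field_simps)
  also have "?N \<dots> \<le> ?N (r *\<^sub>R y) + ?N ((1 - r) *\<^sub>R y')"
    using norm unfolding is_norm_def by blast
  also have "\<dots> = r * ?N y + (1 - r) * ?N y'"
    using norm r by (simp add: is_norm_def)
  finally show ?thesis by (simp add: y' algebra_simps)
qed

text \<open>The coordinates are lowered from \<open>y\<close> to \<open>x\<close> one at a time;
  \<open>S\<close> collects those already lowered.\<close>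

lemma even_norm_mono:
  fixes \<Phi> :: "real ^ 'n \<Rightarrow> real"
  assumes norm: "is_norm (even_extension \<Phi>)" and xy: "\<And>i. 0 \<le> x $ i" "\<And>i. x $ i \<le> y $ i"
  shows "\<Phi> x \<le> \<Phi> y"
proof -
  let ?N = "even_extension \<Phi>"
  have "?N (\<chi> i. if i \<in> S then x $ i else y $ i) \<le> ?N y" if "finite S" for S
    using that
  proof induction
    case empty
    then show ?case by (simp add: vec_nth_inverse)
  next
    case (insert k S)
    let ?z = "\<chi> i. if i \<in> S then x $ i else y $ i"
    have "(\<chi> i. if i \<in> insert k S then x $ i else y $ i) = (\<chi> i. if i = k then x $ k else ?z $ i)"
      by (simp add: vec_eq_iff)
    also have "?N \<dots> \<le> ?N ?z"
      using insert.hyps xy by (intro even_norm_lower_coordinate[OF norm]) auto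
    finally show ?case using insert.IH by simp
  qed
  from this[of UNIV] have "?N x \<le> ?N y" by (simp add: vec_nth_inverse)
  moreover have "0 \<le> y $ i" for i
    using xy order_trans by blast
  ultimately show ?thesis using xy by (simp add: even_extension_eq)
qed

lemma inner_metric_space_product:
  fixes \<Phi> :: "real ^ 'n \<Rightarrow> real" and X :: "'n \<Rightarrow> 'a set"
  assumes norm: "is_norm (even_extension \<Phi>)" and X: "\<And>i. inner_metric_space (X i) (d i)"
  shows "inner_metric_space (\<Pi>\<^sub>E i\<in>UNIV. X i) (product_dist \<Phi> d)"
proof -
  let ?N = "even_extension \<Phi>"
  have M: "Metric_space (X i) (d i)" for i
    using X by (simp add: inner_metric_space_def)
  note d = Metric_space.nonneg[OF M] Metric_space.commute[OF M] Metric_space.zero[OF M]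
    Metric_space.triangle[OF M]
  have N: "product_dist \<Phi> d x y = ?N (\<chi> i. d i (x i) (y i))" for x y
    by (simp add: product_dist_def even_extension_eq d)
  have N0: "0 \<le> ?N v" "?N v = 0 \<longleftrightarrow> v = 0" "?N (a *\<^sub>R v) = \<bar>a\<bar> * ?N v" "?N (v + w) \<le> ?N v + ?N w"
    for v w a using norm by (auto simp: is_norm_def)
  have N_mono: "?N v \<le> ?N w" if "\<And>i. 0 \<le> v $ i" "\<And>i. v $ i \<le> w $ i" for v w
  proof -
    have "0 \<le> w $ i" for i using that order_trans by blast
    then show ?thesis using even_norm_mono[OF norm that] that by (simp add: even_extension_eq)
  qed
  show ?thesis
  proof (rule inner_metric_spaceI)
    show "Metric_space (\<Pi>\<^sub>E i\<in>UNIV. X i) (product_dist \<Phi> d)"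
    proof
      fix x y z
      show "0 \<le> product_dist \<Phi> d x y" by (simp add: N N0)
      show "product_dist \<Phi> d x y = product_dist \<Phi> d y x"
        by (simp add: product_dist_def d(2)[of _ "x _"])
      assume x: "x \<in> (\<Pi>\<^sub>E i\<in>UNIV. X i)" and y: "y \<in> (\<Pi>\<^sub>E i\<in>UNIV. X i)"
      then show "product_dist \<Phi> d x y = 0 \<longleftrightarrow> x = y"
        by (auto simp: N N0 vec_eq_iff PiE_iff d fun_eq_iff)
      assume z: "z \<in> (\<Pi>\<^sub>E i\<in>UNIV. X i)"
      \<comment> \<open>Monotonicity carries the triangle inequalities of the factors into
        \<open>?N\<close>; subadditivity then splits the sum.\<close>
      have "?N (\<chi> i. d i (x i) (z i)) \<le> ?N ((\<chi> i. d i (x i) (y i)) + (\<chi> i. d i (y i) (z i)))"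
        using x y z by (intro N_mono) (auto simp: PiE_iff d)
      also have "\<dots> \<le> ?N (\<chi> i. d i (x i) (y i)) + ?N (\<chi> i. d i (y i) (z i))"
        by (rule N0)
      finally show "product_dist \<Phi> d x z \<le> product_dist \<Phi> d x y + product_dist \<Phi> d y z"
        by (simp add: N)
    qed
    fix x y L
    assume x: "x \<in> (\<Pi>\<^sub>E i\<in>UNIV. X i)" and y: "y \<in> (\<Pi>\<^sub>E i\<in>UNIV. X i)"
      and L: "product_dist \<Phi> d x y < L"
    define v where "v = (\<chi> i. d i (x i) (y i))"
    \<comment> \<open>Every coordinate of \<open>v\<close> is raised by \<open>e\<close>, because a
      Lipschitz path in a factor needs a constant strictly above the distance. The size of
      \<open>e\<close> keeps \<open>?N w\<close> below \<open>L\<close>, and the summand 1 makes the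
      denominator positive.\<close>
    define e where "e = (L - ?N v) / (?N 1 + 1)"
    define w where "w = v + e *\<^sub>R 1"
    have L: "?N v < L" using L by (simp add: N v_def)
    have e: "e > 0"
      using L N0(1)[of 1] by (auto simp: e_def intro!: divide_pos_pos)
    have w_nth: "w $ i = d i (x i) (y i) + e" for i
      by (simp add: w_def v_def)
    have "?N w \<le> ?N v + e * ?N 1"
      unfolding w_def using N0(4)[of v "e *\<^sub>R 1"] N0(3)[of e 1] e by simp
    also have "\<dots> \<le> ?N v + e * (?N 1 + 1)"
      using e by simp
    also have "\<dots> = L"
      using N0(1)[of 1] by (simp add: e_def)
    finally have wL: "?N w \<le> L" .
    have "\<exists>b. (\<forall>s\<in>{0..1}. b s \<in> X i) \<and> b 0 = x i \<and> b 1 = y i \<and>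
        (\<forall>s t. 0 \<le> s \<longrightarrow> s \<le> t \<longrightarrow> t \<le> 1 \<longrightarrow> d i (b s) (b t) \<le> w $ i * (t - s))" for i
    proof -
      have "x i \<in> X i" "y i \<in> X i" "d i (x i) (y i) < w $ i"
        using x y e by (auto simp: w_nth)
      then show ?thesis
        by (rule inner_metric_space_Lipschitz_path[OF X[of i]]) blast
    qed
    then obtain b where b: "\<And>i s. s \<in> {0..1} \<Longrightarrow> b i s \<in> X i" "\<And>i. b i 0 = x i" "\<And>i. b i 1 = y i"
      "\<And>i s t. 0 \<le> s \<Longrightarrow> s \<le> t \<Longrightarrow> t \<le> 1 \<Longrightarrow> d i (b i s) (b i t) \<le> w $ i * (t - s)"
      by metis
    have "product_dist \<Phi> d (\<lambda>i. b i s) (\<lambda>i. b i t) \<le> L * (t - s)"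
      if st: "0 \<le> s" "s \<le> t" "t \<le> 1" for s t
    proof -
      \<comment> \<open>The factor paths run simultaneously, so between times \<open>s\<close> and
        \<open>t\<close> the vector of distances is dominated by
        \<open>(t - s) *\<^sub>R w\<close>.\<close>
      have "?N (\<chi> i. d i (b i s) (b i t)) \<le> ?N ((t - s) *\<^sub>R w)"
        using b(4)[OF st] by (intro N_mono) (auto simp: d mult.commute)
      also have "\<dots> = (t - s) * ?N w"
        using st by (simp add: N0)
      also have "\<dots> \<le> (t - s) * L"
        using wL st by (intro mult_left_mono) auto
      finally show ?thesis by (simp add: N mult.commute)
    qed
    then show "\<exists>c. (\<forall>s\<in>{0..1}. c s \<in> (\<Pi>\<^sub>E i\<in>UNIV. X i)) \<and> c 0 = x \<and> c 1 = y \<and>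
        (\<forall>s t. 0 \<le> s \<longrightarrow> s \<le> t \<longrightarrow> t \<le> 1 \<longrightarrow> product_dist \<Phi> d (c s) (c t) \<le> L * (t - s))"
      using b(1-3) by (intro exI[of _ "\<lambda>s i. b i s"]) auto
  qed
qed

subsection \<open>Homogeneity from short chains\<close>

lemma subadditive_nat_multiple:
  fixes p :: "'e::real_vector \<Rightarrow> real"
  assumes "\<And>x y. p (x + y) \<le> p x + p y" "p 0 = 0"
  shows "p (of_nat m *\<^sub>R x) \<le> of_nat m * p x"
proof (induction m)
  case (Suc m)
  have "p (of_nat (Suc m) *\<^sub>R x) \<le> p (of_nat m *\<^sub>R x) + p x"
    using assms(1)[of "of_nat m *\<^sub>R x" x] by (simp add: algebra_simps)
  then show ?case using Suc by (simp add: algebra_simps)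
qed (use assms in simp)

lemma telescoping_subadditive:
  fixes p :: "'e::real_vector \<Rightarrow> real"
  assumes "\<And>x y. p (x + y) \<le> p x + p y" "p 0 \<le> 0"
  shows "p (w m - w 0) \<le> (\<Sum>j<m. p (w (Suc j) - w j))"
proof (induction m)
  case (Suc m)
  have "p (w (Suc m) - w 0) \<le> p (w m - w 0) + p (w (Suc m) - w m)"
    using assms(1)[of "w m - w 0" "w (Suc m) - w m"] by (simp add: algebra_simps)
  then show ?case using Suc by simp
qed (use assms in simp)

text \<open>The homogeneous majorant \<open>M x = sup p(tx)/t\<close> is almost attained for small \<open>t\<close>, uniformly in
  the direction. Hence \<open>M\<close> and \<open>p\<close> give nearly the same length to a fine chain from 0 to \<open>x\<close>, and
  a chain of \<open>p\<close>-length close to \<open>p x\<close> forces \<open>M x \<le> p x\<close>.\<close>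

lemma is_norm_if_short_chains:
  fixes p :: "'e::euclidean_space \<Rightarrow> real"
  assumes c: "0 < c" and lower: "\<And>x. c * norm x \<le> p x"
    and C: "0 < C" and upper: "\<And>x. p x \<le> C * norm x"
    and sub: "\<And>x y. p (x + y) \<le> p x + p y" and even: "\<And>x. p (- x) = p x"
    and chain: "\<And>x \<delta> \<epsilon>. 0 < \<delta> \<Longrightarrow> 0 < \<epsilon> \<Longrightarrow> \<exists>m w. w 0 = 0 \<and> w m = x \<and>
      (\<forall>j<m. norm (w (Suc j) - w j) < \<delta>) \<and> (\<Sum>j<m. p (w (Suc j) - w j)) \<le> p x + \<epsilon>"
  shows "is_norm p"
proof -
  have p_nonneg: "0 \<le> p x" for x
    using lower[of x] c by (smt (verit) mult_nonneg_nonneg norm_ge_zero)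
  have p0: "p 0 = 0"
    using upper[of 0] p_nonneg[of 0] by simp
  define M where "M x = (SUP t\<in>{0<..}. p (t *\<^sub>R x) / t)" for x
  have quot: "p (t *\<^sub>R x) / t \<le> C * norm x" if "t > 0" for t x
    using upper[of "t *\<^sub>R x"] that by (simp add: field_simps)
  have bdd: "bdd_above ((\<lambda>t. p (t *\<^sub>R x) / t) ` {0<..})" for x
    using quot by (intro bdd_aboveI[of _ "C * norm x"]) auto
  have M_upper: "p (t *\<^sub>R x) / t \<le> M x" if "t > 0" for t x
    unfolding M_def using that bdd by (intro cSUP_upper) auto
  have M_least: "M x \<le> B" if "\<And>t. t > 0 \<Longrightarrow> p (t *\<^sub>R x) / t \<le> B" for x B
    unfolding M_def using that by (intro cSUP_least) auto
  have M_approx: "\<exists>t>0. B < p (t *\<^sub>R x) / t" if "B < M x" for x B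
    using that M_least[of x B] by (meson not_le)
  have p_le_M: "p x \<le> M x" for x
    using M_upper[of 1 x] by simp
  have M_le_norm: "M x \<le> C * norm x" for x
    using quot by (rule M_least)
  have M_sub: "M (x + y) \<le> M x + M y" for x y
  proof (rule M_least)
    fix t :: real assume "t > 0"
    then have "p (t *\<^sub>R (x + y)) / t \<le> p (t *\<^sub>R x) / t + p (t *\<^sub>R y) / t"
      using sub[of "t *\<^sub>R x" "t *\<^sub>R y"] by (simp add: scaleR_add_right field_simps)
    then show "p (t *\<^sub>R (x + y)) / t \<le> M x + M y"
      using M_upper[OF \<open>t > 0\<close>, of x] M_upper[OF \<open>t > 0\<close>, of y] by linarith
  qed
  have M_scale_le: "M (a *\<^sub>R x) \<le> a * M x" if "a > 0" for a x
  proof (rule M_least)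
    fix t :: real assume "t > 0"
    then show "p (t *\<^sub>R a *\<^sub>R x) / t \<le> a * M x"
      using M_upper[of "t * a" x] that by (simp add: field_simps)
  qed
  have M_scale: "M (a *\<^sub>R x) = a * M x" if "a > 0" for a x
    using M_scale_le[OF that, of x] M_scale_le[of "inverse a" "a *\<^sub>R x"] that
    by (simp add: field_simps)
  \<comment> \<open>Choose \<open>s\<close> with \<open>p (s *\<^sub>R u) / s\<close> close to
    \<open>M u\<close>. For \<open>t\<close> much smaller than \<open>s\<close>, the vector
    \<open>s *\<^sub>R u\<close> consists of \<open>m\<close> copies of \<open>t *\<^sub>R u\<close>
    and a remainder of norm at most \<open>t\<close>, so the quotient at \<open>t\<close> is nearly
    as large. The error \<eta> is made of four quarters: the choice of \<open>s\<close>, the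
    remainder, and the two passages between \<open>u\<close> and \<open>u'\<close>, for which the
    radius of the ball is chosen.\<close>
  have local_bound: "\<exists>s>0. \<forall>u'\<in>ball u (\<eta> / (4 * C)). \<forall>t. 0 < t \<longrightarrow> t < s \<longrightarrow>
      M u' \<le> p (t *\<^sub>R u') / t + \<eta>"
    if u: "norm u = 1" and \<eta>: "\<eta> > 0" for u \<eta>
  proof -
    obtain s where s: "s > 0" "M u - \<eta> / 4 < p (s *\<^sub>R u) / s"
      using M_approx[of "M u - \<eta> / 4" u] \<eta> by auto
    have "M u' \<le> p (t *\<^sub>R u') / t + \<eta>"
      if u': "u' \<in> ball u (\<eta> / (4 * C))" and t: "0 < t" "t < s * \<eta> / (4 * C)" for u' t
    proof -
      define m where "m = nat \<lfloor>s / t\<rfloor>"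
      define r where "r = s - m * t"
      have m: "real m \<le> s / t" "s / t < real m + 1"
        using s t by (auto simp: m_def)
      have r: "0 \<le> r" "r \<le> t"
        using m t by (auto simp: r_def field_simps)
      have "s *\<^sub>R u = of_nat m *\<^sub>R t *\<^sub>R u + r *\<^sub>R u"
        by (simp add: r_def algebra_simps)
      then have "p (s *\<^sub>R u) \<le> p (of_nat m *\<^sub>R t *\<^sub>R u) + p (r *\<^sub>R u)"
        using sub by metis
      also have "p (of_nat m *\<^sub>R t *\<^sub>R u) \<le> m * p (t *\<^sub>R u)"
        using sub p0 by (rule subadditive_nat_multiple)
      also have "\<dots> \<le> s / t * p (t *\<^sub>R u)"
        using m p_nonneg by (intro mult_right_mono) auto
      also have "p (r *\<^sub>R u) \<le> C * t"
      proof -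
        have "p (r *\<^sub>R u) \<le> C * r" using upper[of "r *\<^sub>R u"] r u by simp
        also have "\<dots> \<le> C * t" using r C by simp
        finally show ?thesis .
      qed
      finally have "p (s *\<^sub>R u) / s \<le> p (t *\<^sub>R u) / t + C * t / s"
        using s t by (simp add: field_simps)
      also have "C * t / s \<le> \<eta> / 4"
        using s t C by (simp add: field_simps)
      finally have 1: "M u \<le> p (t *\<^sub>R u) / t + \<eta> / 2"
        using s by simp
      have near: "C * norm (u - u') \<le> \<eta> / 4" "C * norm (u' - u) \<le> \<eta> / 4"
        using u' C by (simp_all add: dist_norm norm_minus_commute field_simps)
      have 2: "M u' \<le> M u + \<eta> / 4"
        using M_sub[of u "u' - u"] M_le_norm[of "u' - u"] near by simp
      have "p (t *\<^sub>R u) \<le> p (t *\<^sub>R u') + p (t *\<^sub>R (u - u'))"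
        using sub[of "t *\<^sub>R u'" "t *\<^sub>R (u - u')"] by (simp add: algebra_simps)
      then have "p (t *\<^sub>R u) / t \<le> p (t *\<^sub>R u') / t + p (t *\<^sub>R (u - u')) / t"
        using t by (simp add: field_simps)
      also have "p (t *\<^sub>R (u - u')) / t \<le> \<eta> / 4"
        using quot[OF t(1), of "u - u'"] near by linarith
      finally show ?thesis using 1 2 by simp
    qed
    moreover have "s * \<eta> / (4 * C) > 0" using s \<eta> C by simp
    ultimately show ?thesis by blast
  qed
  have uniform: "\<exists>\<delta>>0. \<forall>v. norm v < \<delta> \<longrightarrow> M v \<le> p v + \<eta> * norm v" if \<eta>: "\<eta> > 0" for \<eta>
  proof -
    obtain s where s: "\<And>u. norm u = 1 \<Longrightarrow> s u > 0"
      "\<And>u u' t. norm u = 1 \<Longrightarrow> u' \<in> ball u (\<eta> / (4 * C)) \<Longrightarrow> 0 < t \<Longrightarrow> t < s u \<Longrightarrow>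
        M u' \<le> p (t *\<^sub>R u') / t + \<eta>"
      using local_bound[OF _ \<eta>] by metis
    \<comment> \<open>Compactness of the unit sphere leaves finitely many directions, and the
      smallest of their thresholds serves for all. The inserted 1 keeps the minimum defined without
      asking whether \<open>K\<close> is empty.\<close>
    have "sphere 0 1 \<subseteq> (\<Union>u\<in>sphere 0 1. ball u (\<eta> / (4 * C)))"
      using \<eta> C by (fastforce intro!: centre_in_ball[THEN iffD2])
    then obtain K where K: "K \<subseteq> sphere 0 (1::real)" "finite K"
      "sphere (0::'e) 1 \<subseteq> (\<Union>u\<in>K. ball u (\<eta> / (4 * C)))"
      using compactE_image[OF compact_sphere, of "sphere 0 1" "\<lambda>u. ball u (\<eta> / (4 * C))"]
      by (metis open_ball)
    define \<delta> where "\<delta> = Min (insert 1 (s ` K))"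
    have \<delta>: "\<delta> > 0" "\<And>u. u \<in> K \<Longrightarrow> \<delta> \<le> s u"
      using K s by (auto simp: \<delta>_def)
    have "M v \<le> p v + \<eta> * norm v" if v: "norm v < \<delta>" for v
    proof (cases "v = 0")
      case True
      then show ?thesis using M_le_norm[of 0] p0 by simp
    next
      case False
      define u' where "u' = v /\<^sub>R norm v"
      have u': "v = norm v *\<^sub>R u'" "norm u' = 1"
        using False by (auto simp: u'_def)
      then obtain u where u: "u \<in> K" "u' \<in> ball u (\<eta> / (4 * C))"
        using K by auto
      then have "M u' \<le> p (norm v *\<^sub>R u') / norm v + \<eta>"
        using s(2)[of u u' "norm v"] K \<delta>(2)[of u] v False by force
      then have "norm v * M u' \<le> norm v * (p v / norm v + \<eta>)"
        using u' by (intro mult_left_mono) auto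
      moreover have "M v = norm v * M u'"
        using u' M_scale[of "norm v" u'] False by simp
      moreover have "norm v * (p v / norm v + \<eta>) = p v + \<eta> * norm v"
        using False by (simp add: field_simps)
      ultimately show ?thesis by simp
    qed
    with \<delta> show ?thesis by blast
  qed
  have M_le_p: "M x \<le> p x" for x
  proof (rule field_le_epsilon)
    fix e :: real assume e: "e > 0"
    \<comment> \<open>With error \<open>c * h * norm v\<close>, the lower bound on \<open>p\<close>
      gives \<open>M v \<le> (1 + h) * p v\<close> for short \<open>v\<close>. Summing over a chain
      gives at most \<open>(1 + h) * (p x + h)\<close>, which for \<open>h \<le> 1\<close> is at
      most \<open>p x + h * (2 + p x)\<close>, hence at most \<open>p x + e\<close>.\<close>
    define h where "h = min 1 (e / (2 + p x))"
    have px: "0 < 2 + p x" using p_nonneg[of x] by linarith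
    then have h: "0 < h" "h \<le> 1" "h \<le> e / (2 + p x)"
      using e by (auto simp: h_def)
    then have he: "h * (2 + p x) \<le> e"
      using px by (simp add: pos_le_divide_eq)
    obtain \<delta> where \<delta>: "\<delta> > 0" "\<And>v. norm v < \<delta> \<Longrightarrow> M v \<le> p v + (c * h) * norm v"
      using uniform[of "c * h"] c h by auto
    obtain m w where w: "w 0 = 0" "w m = x" "\<And>j. j < m \<Longrightarrow> norm (w (Suc j) - w j) < \<delta>"
      "(\<Sum>j<m. p (w (Suc j) - w j)) \<le> p x + h"
      using chain[OF \<delta>(1) h(1), of x] by blast
    have "M x \<le> (\<Sum>j<m. M (w (Suc j) - w j))"
      using telescoping_subadditive[of M w m] M_sub M_le_norm[of 0] w by simp
    also have "\<dots> \<le> (\<Sum>j<m. (1 + h) * p (w (Suc j) - w j))"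
    proof (rule sum_mono)
      fix j assume "j \<in> {..<m}"
      then have "M (w (Suc j) - w j) \<le> p (w (Suc j) - w j) + h * (c * norm (w (Suc j) - w j))"
        using \<delta>(2)[OF w(3)] by (simp add: mult_ac)
      also have "\<dots> \<le> p (w (Suc j) - w j) + h * p (w (Suc j) - w j)"
        using lower h by (intro add_left_mono mult_left_mono) auto
      finally show "M (w (Suc j) - w j) \<le> (1 + h) * p (w (Suc j) - w j)"
        by (simp add: algebra_simps)
    qed
    also have "\<dots> = (1 + h) * (\<Sum>j<m. p (w (Suc j) - w j))"
      by (simp add: sum_distrib_left)
    also have "\<dots> \<le> (1 + h) * (p x + h)"
      using w h by (intro mult_left_mono) auto
    also have "\<dots> = p x + h * (1 + p x + h)"
      by (simp add: algebra_simps)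
    also have "\<dots> \<le> p x + h * (2 + p x)"
      using h by (intro add_left_mono mult_left_mono) auto
    also have "\<dots> \<le> p x + e" using he by simp
    finally show "M x \<le> p x + e" .
  qed
  have "M = p" using M_le_p p_le_M by (intro ext antisym)
  then have scale: "p (a *\<^sub>R x) = a * p x" if "a > 0" for a x
    using M_scale that by simp
  show ?thesis
    unfolding is_norm_def
  proof (intro conjI allI)
    fix x y :: 'e and a :: real
    show "p x = 0 \<longleftrightarrow> x = 0"
      using lower[of x] c p0 by (auto simp: mult_le_0_iff)
    show "p (a *\<^sub>R x) = \<bar>a\<bar> * p x"
      using scale[of a x] scale[of "- a" x] even[of "a *\<^sub>R x"] p0
      by (cases a "0::real" rule: linorder_cases) auto
  qed (use p_nonneg sub in auto)
qed

text \<open>Nonnegativity makes \<phi> monotone. Enclosing \<open>n * t\<close> between consecutive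
  integers bounds \<open>n\<close> times the deviation from linearity by \<open>\<phi> 1\<close>,
  for every \<open>n\<close>, so the deviation vanishes.\<close>

lemma additive_nonneg_imp_linear:
  fixes \<phi> :: "real \<Rightarrow> real"
  assumes add: "\<And>s t. 0 \<le> s \<Longrightarrow> 0 \<le> t \<Longrightarrow> \<phi> (s + t) = \<phi> s + \<phi> t"
    and nonneg: "\<And>t. 0 \<le> t \<Longrightarrow> 0 \<le> \<phi> t" and t: "0 \<le> t"
  shows "\<phi> t = t * \<phi> 1"
proof -
  have mono: "\<phi> s \<le> \<phi> r" if "0 \<le> s" "s \<le> r" for s r
    using add[of s "r - s"] nonneg[of "r - s"] that by simp
  have \<phi>0: "\<phi> 0 = 0" using add[of 0 0] by simp
  have mult: "\<phi> (real n * s) = real n * \<phi> s" if "0 \<le> s" for n s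
  proof (induction n)
    case (Suc n)
    then show ?case using add[of "real n * s" s] that by (simp add: algebra_simps)
  qed (simp add: \<phi>0)
  have "real n * \<bar>\<phi> t - t * \<phi> 1\<bar> \<le> \<phi> 1" for n
  proof -
    define k where "k = nat \<lfloor>real n * t\<rfloor>"
    have "real k = of_int \<lfloor>real n * t\<rfloor>"
      using t by (simp add: k_def)
    then have k: "real k \<le> real n * t" "real n * t < real (Suc k)"
      by linarith+
    have "\<phi> (real k * 1) \<le> \<phi> (real n * t)" "\<phi> (real n * t) \<le> \<phi> (real (Suc k) * 1)"
      using k t by (auto intro!: mono)
    then have "real k * \<phi> 1 \<le> real n * \<phi> t" "real n * \<phi> t \<le> (real k + 1) * \<phi> 1"
      unfolding mult[OF t] mult[OF zero_le_one] by (auto simp: add.commute)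
    moreover have "real k * \<phi> 1 \<le> real n * t * \<phi> 1" "real n * t * \<phi> 1 \<le> (real k + 1) * \<phi> 1"
      using k nonneg[of 1] by (auto intro!: mult_right_mono)
    ultimately have "\<bar>real n * \<phi> t - real n * t * \<phi> 1\<bar> \<le> \<phi> 1"
      by (simp add: algebra_simps abs_le_iff)
    moreover have "real n * \<phi> t - real n * t * \<phi> 1 = real n * (\<phi> t - t * \<phi> 1)"
      by (simp add: algebra_simps)
    ultimately show ?thesis by (simp add: abs_mult)
  qed
  then have "\<bar>\<phi> t - t * \<phi> 1\<bar> \<le> 0"
    by (meson not_le reals_Archimedean3)
  then show ?thesis by simp
qed

subsection \<open>Functions preserving inner metric spaces\<close>

text \<open>Composed with an injection of the reals, this places the plane inside
  \<open>'a\<close>.\<close>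

lemma inj_real_pair: "\<exists>h :: real \<times> real \<Rightarrow> real. inj h"
proof -
  obtain h :: "real \<times> real \<Rightarrow> real" where "bij_betw h (UNIV \<times> UNIV) UNIV"
    using card_of_ordIso[THEN iffD2, OF card_of_Times_same_infinite[OF infinite_UNIV_char_0]] by blast
  then show ?thesis by (auto simp: bij_betw_def)
qed

text \<open>The setting of the converse: \<Phi> preserves inner metric spaces with points in
  \<open>'a\<close>, and \<open>f\<close> turns real numbers into such points.\<close>

locale inner_preserving =
  fixes \<Phi> :: "real ^ 'n \<Rightarrow> real" and f :: "real \<Rightarrow> 'a"
  assumes inj_f: "inj f"
    and inner_product_space: "\<And>(X :: 'n \<Rightarrow> 'a set) d. (\<And>i. inner_metric_space (X i) (d i)) \<Longrightarrow>
      inner_metric_space (\<Pi>\<^sub>E i\<in>UNIV. X i) (product_dist \<Phi> d)"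
begin

abbreviation N where "N \<equiv> even_extension \<Phi>"

lemma inner_product_convex:
  fixes g :: "'b::real_normed_vector \<Rightarrow> 'a"
  assumes "inj g" "\<And>i. convex (S i)"
  shows "inner_metric_space (\<Pi>\<^sub>E i\<in>UNIV. g ` S i)
    (product_dist \<Phi> (\<lambda>i x y. dist (inv g x) (inv g y)))"
  using assms by (intro inner_product_space inner_metric_space_convex_image)

text \<open>Distances in the plane realize all triangles; on the line only \<open>a = b + c\<close> would be
  available, which is too weak to relate \<open>\<Phi> a\<close> and \<open>\<Phi> b\<close> when \<open>a \<le> 2 b\<close>.\<close>

lemma planar_triangle:
  fixes P Q R :: "'n \<Rightarrow> real \<times> real"
  shows "\<Phi> (\<chi> i. dist (P i) (R i)) \<le> \<Phi> (\<chi> i. dist (P i) (Q i)) + \<Phi> (\<chi> i. dist (Q i) (R i))"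
proof -
  obtain h :: "real \<times> real \<Rightarrow> real" where "inj h" using inj_real_pair by blast
  define g where "g = f \<circ> h"
  have g: "inj g" using \<open>inj h\<close> inj_f by (simp add: g_def inj_compose)
  let ?d = "product_dist \<Phi> (\<lambda>i x y. dist (inv g x) (inv g y))"
  have "Metric_space (\<Pi>\<^sub>E i\<in>UNIV. range g) ?d"
    using inner_product_convex[OF g, of "\<lambda>_. UNIV"] by (simp add: inner_metric_space_def)
  then have "?d (\<lambda>i. g (P i)) (\<lambda>i. g (R i))
      \<le> ?d (\<lambda>i. g (P i)) (\<lambda>i. g (Q i)) + ?d (\<lambda>i. g (Q i)) (\<lambda>i. g (R i))"
    by (rule Metric_space.triangle) auto
  then show ?thesis using g by (simp add: product_dist_def)
qed

text \<open>A triangle with base \<open>a $ i\<close> and two legs \<open>b $ i\<close> exists in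
  the plane exactly because the base is at most twice the leg; \<open>Q i\<close> is its apex. This
  replaces monotonicity of \<Phi>, up to the factor 2.\<close>

lemma isosceles:
  assumes "\<And>i. 0 \<le> a $ i" "\<And>i. a $ i \<le> 2 * b $ i"
  shows "\<Phi> a \<le> 2 * \<Phi> b"
proof -
  define Q where "Q i = (a $ i / 2, sqrt ((b $ i)\<^sup>2 - (a $ i / 2)\<^sup>2))" for i
  have b: "0 \<le> b $ i" for i using assms[of i] by linarith
  have sq: "(a $ i / 2)\<^sup>2 \<le> (b $ i)\<^sup>2" for i
    using assms[of i] by (intro power_mono) auto
  have "dist (0, 0) (Q i) = b $ i" "dist (Q i) (a $ i, 0) = b $ i" for i
    using sq[of i] b[of i] by (simp_all add: Q_def dist_Pair_Pair dist_real_def power_divide)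
  moreover have "dist (0, 0) (a $ i, 0::real) = a $ i" for i
    using assms(1)[of i] by (simp add: dist_Pair_Pair)
  ultimately show ?thesis
    using planar_triangle[of "\<lambda>_. (0, 0)" "\<lambda>i. (a $ i, 0)" Q] by (simp add: vec_nth_inverse)
qed

section \<open>Subadditivity, symmetry and definiteness of \<open>N\<close>\<close>

lemma N_sub: "N (x + y) \<le> N x + N y"
  \<comment> \<open>In each factor the three points are the collinear \<open>x $ i + y $ i\<close>,
    \<open>y $ i\<close> and 0.\<close>
  using planar_triangle[of "\<lambda>i. (x $ i + y $ i, 0)" "\<lambda>_. (0, 0)" "\<lambda>i. (y $ i, 0)"]
  by (simp add: even_extension_def dist_Pair_Pair dist_real_def)

lemma N_minus: "N (- x) = N x"
  by (simp add: even_extension_def)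

lemma N_bound: "\<Phi> a \<le> 2 * N x" if "\<And>i. 0 \<le> a $ i" "\<And>i. a $ i \<le> 2 * \<bar>x $ i\<bar>"
  unfolding even_extension_def using that by (intro isosceles) auto

abbreviation real_dist where "real_dist \<equiv> product_dist \<Phi> (\<lambda>i x y. dist (inv f x) (inv f y))"

lemma real_dist_eq: "real_dist x y = N ((\<chi> i. inv f (x i)) - (\<chi> i. inv f (y i)))"
  by (simp add: product_dist_def even_extension_def dist_real_def)

lemma Metric_space_line: "Metric_space (\<Pi>\<^sub>E i\<in>UNIV. range f) real_dist"
  using inner_product_convex[OF inj_f, of "\<lambda>_. UNIV"] by (simp add: inner_metric_space_def)

lemma N_nonneg: "0 \<le> N x"
proof -
  have "0 \<le> real_dist (\<lambda>i. f (x $ i)) (\<lambda>i. f 0)"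
    using Metric_space_line by (rule Metric_space.nonneg)
  also have "\<dots> = N x"
    using inj_f by (simp add: product_dist_def even_extension_def)
  finally show ?thesis .
qed

lemma N_zero_iff: "N x = 0 \<longleftrightarrow> x = 0"
proof -
  have "real_dist (\<lambda>i. f (x $ i)) (\<lambda>i. f 0) = 0 \<longleftrightarrow> (\<lambda>i. f (x $ i)) = (\<lambda>i. f 0)"
    using Metric_space_line by (rule Metric_space.zero) auto
  also have "\<dots> \<longleftrightarrow> x = 0"
    using inj_f by (auto simp: fun_eq_iff vec_eq_iff inj_eq)
  finally show ?thesis
    using inj_f by (simp add: product_dist_def even_extension_def)
qed

text \<open>By \<open>N_bound\<close>, a coordinate of size at least \<open>e\<close> forces
  \<open>N x\<close> to be at least half the value of \<open>N\<close> at the axis vector of length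
  \<open>e\<close>. This makes paths for the product metric continuous in the usual sense.\<close>

lemma coordinate_small:
  assumes "e > 0"
  shows "\<exists>\<delta>>0. \<forall>x. N x < \<delta> \<longrightarrow> \<bar>x $ i\<bar> < e"
proof (intro exI conjI allI impI)
  have axis: "0 \<le> axis i e $ j" for j
    using assms by (simp add: axis_def)
  have "0 < N (axis i e)"
    using N_nonneg[of "axis i e"] N_zero_iff[of "axis i e"] assms
    by (simp add: axis_eq_0_iff less_le)
  then show "N (axis i e) / 2 > 0" by simp
  fix x assume x: "N x < N (axis i e) / 2"
  show "\<bar>x $ i\<bar> < e"
  proof (rule ccontr)
    assume "\<not> \<bar>x $ i\<bar> < e"
    then have "\<Phi> (axis i e) \<le> 2 * N x"
      using assms axis by (intro N_bound) (auto simp: axis_def)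
    then show False using x axis by (simp add: even_extension_eq)
  qed
qed

text \<open>An almost shortest path for the product metric, carried back to vectors by inverting
  \<open>f\<close> in each coordinate. The sets \<open>S i\<close> allow single factors to be shrunk
  to a point.\<close>

lemma short_path:
  fixes S :: "'n \<Rightarrow> real set" and x y :: "real ^ 'n"
  assumes S: "\<And>i. convex (S i)" "\<And>i. x $ i \<in> S i" "\<And>i. y $ i \<in> S i" and e: "e > 0"
  shows "\<exists>c :: real \<Rightarrow> real ^ 'n. continuous_on {0..1} c \<and> c 0 = x \<and> c 1 = y \<and>
    (\<forall>s\<in>{0..1}. \<forall>i. c s $ i \<in> S i) \<and>
    (\<forall>k t. t 0 = 0 \<longrightarrow> t k = 1 \<longrightarrow> (\<forall>j<k. t j \<le> t (Suc j)) \<longrightarrow>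
      (\<Sum>j<k. N (c (t (Suc j)) - c (t j))) \<le> N (y - x) + e)"
proof -
  let ?M = "\<Pi>\<^sub>E i\<in>UNIV. f ` S i"
  let ?P = "{c. pathin (Metric_space.mtopology ?M real_dist) c \<and>
    c 0 = (\<lambda>i. f (x $ i)) \<and> c 1 = (\<lambda>i. f (y $ i))}"
  have inner: "inner_metric_space ?M real_dist"
    using inj_f S(1) by (rule inner_product_convex)
  then have M: "Metric_space ?M real_dist"
    by (simp add: inner_metric_space_def)
  have "N (x - y) = N (y - x)"
    using N_minus[of "x - y"] by simp
  then have "ereal (N (y - x)) = ereal (real_dist (\<lambda>i. f (x $ i)) (\<lambda>i. f (y $ i)))"
    using inj_f by (simp add: real_dist_eq)
  also have "\<dots> = (INF c\<in>?P. path_length real_dist c)"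
    using inner S(2,3) unfolding inner_metric_space_def by blast
  finally have "(INF c\<in>?P. path_length real_dist c) < ereal (N (y - x) + e)"
    using e by (metis less_add_same_cancel1 less_ereal.simps(1))
  then obtain b where b: "pathin (Metric_space.mtopology ?M real_dist) b"
    "b 0 = (\<lambda>i. f (x $ i))" "b 1 = (\<lambda>i. f (y $ i))"
    "path_length real_dist b < ereal (N (y - x) + e)"
    by (auto simp: INF_less_iff)
  note path = b(1)[unfolded pathin_mtopology_iff[OF M]]
  define c where "c s = (\<chi> i. inv f (b s i))" for s
  have N: "real_dist (b s) (b t) = N (c t - c s)" for s t
    using N_minus[of "c s - c t"] by (simp add: real_dist_eq c_def)
  show ?thesis
  proof (intro exI[of _ c] conjI ballI allI impI)
    show "c 0 = x" "c 1 = y"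
      using b inj_f by (simp_all add: c_def vec_eq_iff)
    show "c s $ i \<in> S i" if "s \<in> {0..1}" for s i
    proof -
      have "b s i \<in> f ` S i" using path that by (auto simp: PiE_iff)
      then show ?thesis using inj_f by (auto simp: c_def)
    qed
    have "continuous_on {0..1} (\<lambda>s. c s $ i)" for i
      unfolding continuous_on_iff
    proof (intro ballI allI impI)
      fix s e :: real assume s: "s \<in> {0..1}" and "e > 0"
      then obtain \<delta> where \<delta>: "\<delta> > 0" "\<And>v. N v < \<delta> \<Longrightarrow> \<bar>v $ i\<bar> < e"
        using coordinate_small[of e i] by blast
      obtain r where "r > 0" "\<forall>t\<in>{0..1}. \<bar>t - s\<bar> < r \<longrightarrow> real_dist (b s) (b t) < \<delta>"
        using path s \<delta>(1) by blast
      then have "\<bar>(c t - c s) $ i\<bar> < e" if "t \<in> {0..1}" "\<bar>t - s\<bar> < r" for t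
        using that \<delta>(2)[of "c t - c s"] by (simp add: N)
      with \<open>r > 0\<close> show "\<exists>r>0. \<forall>t\<in>{0..1}. dist t s < r \<longrightarrow> dist (c t $ i) (c s $ i) < e"
        by (intro exI[of _ r]) (simp add: dist_real_def)
    qed
    then have "continuous_on {0..1} (\<lambda>s. \<chi> i. c s $ i)"
      by (rule continuous_on_vec_lambda)
    then show "continuous_on {0..1} c"
      by (simp add: vec_nth_inverse)
    fix k and t :: "nat \<Rightarrow> real"
    assume t: "t 0 = 0" "t k = 1" "\<forall>j<k. t j \<le> t (Suc j)"
    have "(\<Sum>j<k. N (c (t (Suc j)) - c (t j))) = (\<Sum>j=1..k. real_dist (b (t (j - 1))) (b (t j)))"
      unfolding N by (simp add: sum.atLeast1_atMost_eq)
    moreover have "ereal (\<Sum>j=1..k. real_dist (b (t (j - 1))) (b (t j))) \<le> path_length real_dist b"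
      using t by (intro path_length_ge_sum) auto
    ultimately show "(\<Sum>j<k. N (c (t (Suc j)) - c (t j))) \<le> N (y - x) + e"
      using b(4) order_le_less_trans by fastforce
  qed
qed

text \<open>All factors but the \<open>i\<close>-th collapse to a point, so a path must pass through every
  intermediate point of the axis.\<close>

lemma N_axis_add:
  assumes s: "0 \<le> s" and t: "0 \<le> t"
  shows "N (axis i (s + t)) = N (axis i s) + N (axis i t)"
proof (rule antisym)
  have split: "axis i (s + t) = axis i s + axis i t"
    by (simp add: vec_eq_iff axis_def)
  then show "N (axis i (s + t)) \<le> N (axis i s) + N (axis i t)"
    using N_sub by simp
  show "N (axis i s) + N (axis i t) \<le> N (axis i (s + t))"
  proof (rule field_le_epsilon)
    fix e :: real assume "e > 0"
    define S where "S j = (if j = i then UNIV else {0::real})" for j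
    have "convex (S j)" "(0::real ^ 'n) $ j \<in> S j" "axis i (s + t) $ j \<in> S j" for j
      by (auto simp: S_def axis_def)
    then obtain c :: "real \<Rightarrow> real ^ 'n" where c: "continuous_on {0..1} c" "c 0 = 0" "c 1 = axis i (s + t)"
      "\<forall>r\<in>{0..1}. \<forall>j. c r $ j \<in> S j"
      "\<forall>k p. p 0 = 0 \<longrightarrow> p k = 1 \<longrightarrow> (\<forall>j<k. p j \<le> p (Suc j)) \<longrightarrow>
        (\<Sum>j<k. N (c (p (Suc j)) - c (p j))) \<le> N (axis i (s + t) - 0) + e"
      using short_path[of S 0 "axis i (s + t)" e] \<open>e > 0\<close> by blast
    have "continuous_on {0..1} (\<lambda>r. c r $ i)"
      using c(1) by (intro continuous_intros)
    then obtain r where r: "0 \<le> r" "r \<le> 1" "c r $ i = s"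
      using IVT'[of "\<lambda>r. c r $ i" 0 s 1] c(2,3) s t by (auto simp: axis_def)
    have cr: "c r = axis i s"
      using bspec[OF c(4), of r] r by (auto simp: vec_eq_iff axis_def S_def split: if_splits)
    \<comment> \<open>The subdivision 0, \<open>r\<close>, 1 passes through \<open>axis i s\<close>,
      so its two steps contribute exactly \<open>N (axis i s)\<close> and
      \<open>N (axis i t)\<close>.\<close>
    define p where "p j = (if j = 0 then 0 else if j = 1 then r else 1)" for j :: nat
    have "(\<Sum>j<2. N (c (p (Suc j)) - c (p j))) \<le> N (axis i (s + t) - 0) + e"
      using r by (intro c(5)[rule_format]) (auto simp: p_def)
    then show "N (axis i s) + N (axis i t) \<le> N (axis i (s + t)) + e"
      using c(2,3) cr split by (simp add: p_def numeral_2_eq_2)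
  qed
qed

section \<open>Comparison of \<open>N\<close> with the Euclidean norm\<close>

lemma N_axis: "N (axis i t) = \<bar>t\<bar> * N (axis i 1)"
proof -
  have "N (axis i t) = N (axis i \<bar>t\<bar>)"
    by (simp add: even_extension_def axis_def if_distrib cong: if_cong)
  also have "\<dots> = \<bar>t\<bar> * N (axis i 1)"
    by (rule additive_nonneg_imp_linear[of "\<lambda>t. N (axis i t)"]) (auto simp: N_axis_add N_nonneg)
  finally show ?thesis .
qed

lemma N_sum: "N (sum g A) \<le> (\<Sum>i\<in>A. N (g i))" if "finite A"
  using that
proof induction
  case empty
  then show ?case using N_zero_iff[of 0] by simp
next
  case (insert a A)
  then show ?case using N_sub[of "g a" "sum g A"] by simp
qed

text \<open>Decompose \<open>x\<close> along the axes, where \<open>N\<close> is linear up to sign.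
  The summand 1 makes the constant evidently positive.\<close>

lemma N_upper: "N x \<le> (1 + (\<Sum>i\<in>UNIV. N (axis i 1))) * norm x"
proof -
  have "x = (\<Sum>i\<in>UNIV. axis i (x $ i))"
    by (simp add: vec_eq_iff axis_def if_distrib sum.delta cong: if_cong)
  then have "N x \<le> (\<Sum>i\<in>UNIV. N (axis i (x $ i)))"
    using N_sum[of UNIV "\<lambda>i. axis i (x $ i)"] by simp
  also have "\<dots> \<le> (\<Sum>i\<in>UNIV. N (axis i 1) * norm x)"
    unfolding N_axis[of _ "x $ _"]
    by (intro sum_mono)
      (simp add: mult.commute[of "N _"] mult_right_mono component_le_norm_cart N_nonneg)
  also have "\<dots> \<le> (1 + (\<Sum>i\<in>UNIV. N (axis i 1))) * norm x"
    by (simp add: algebra_simps sum_distrib_left)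
  finally show ?thesis .
qed

text \<open>Comparing \<open>x\<close> with its component along one axis bounds
  \<open>\<bar>x $ i\<bar> * N (axis i 1)\<close> by \<open>2 * N x\<close>; the sum of the absolute
  coordinates then dominates the Euclidean norm.\<close>

lemma N_lower: "\<exists>c>0. \<forall>x. c * norm x \<le> N x"
proof -
  have pos: "0 < N (axis i 1)" for i
    using N_nonneg[of "axis i 1"] N_zero_iff[of "axis i 1"] by (simp add: axis_eq_0_iff less_le)
  define K where "K = (\<Sum>i\<in>UNIV. 2 / N (axis i 1))"
  have K: "K > 0"
    unfolding K_def using pos by (intro sum_pos) auto
  have coord: "\<bar>x $ i\<bar> \<le> 2 / N (axis i 1) * N x" for x i
  proof -
    have "N (axis i (x $ i)) = \<Phi> (axis i \<bar>x $ i\<bar>)"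
      by (simp add: even_extension_def axis_def if_distrib cong: if_cong)
    also have "\<dots> \<le> 2 * N x"
      by (rule N_bound) (auto simp: axis_def)
    finally show ?thesis
      using pos[of i] unfolding N_axis[of i "x $ i"] by (simp add: field_simps)
  qed
  have "norm x \<le> K * N x" for x
  proof -
    have "norm x \<le> (\<Sum>i\<in>UNIV. \<bar>x $ i\<bar>)" by (rule norm_le_l1_cart)
    also have "\<dots> \<le> (\<Sum>i\<in>UNIV. 2 / N (axis i 1) * N x)" by (intro sum_mono coord)
    finally show ?thesis by (simp add: K_def sum_distrib_right)
  qed
  then have "\<forall>x. 1 / K * norm x \<le> N x"
    using K by (simp add: field_simps)
  then show ?thesis using K by (metis zero_less_divide_1_iff)
qed

text \<open>By uniform continuity, a fine equidistant subdivision of an almost shortest path from 0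
  to \<open>x\<close> has small Euclidean steps.\<close>

lemma N_short_chain:
  assumes "0 < \<delta>" "0 < e"
  shows "\<exists>m w. w 0 = 0 \<and> w m = x \<and> (\<forall>j<m. norm (w (Suc j) - w j) < \<delta>) \<and>
    (\<Sum>j<m. N (w (Suc j) - w j)) \<le> N x + e"
proof -
  obtain c :: "real \<Rightarrow> real ^ 'n" where c: "continuous_on {0..1} c" "c 0 = 0" "c 1 = x"
    "\<forall>k p. p 0 = 0 \<longrightarrow> p k = 1 \<longrightarrow> (\<forall>j<k. p j \<le> p (Suc j)) \<longrightarrow>
      (\<Sum>j<k. N (c (p (Suc j)) - c (p j))) \<le> N (x - 0) + e"
    using short_path[of "\<lambda>_. UNIV" 0 x e, OF convex_UNIV UNIV_I UNIV_I assms(2)] by blast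
  have "uniformly_continuous_on {0..1} c"
    using c(1) by (intro compact_uniformly_continuous) auto
  then obtain r where r: "r > 0"
    "\<And>s t. s \<in> {0..1} \<Longrightarrow> t \<in> {0..1} \<Longrightarrow> dist t s < r \<Longrightarrow> dist (c t) (c s) < \<delta>"
    using assms(1) unfolding uniformly_continuous_on_def by blast
  obtain m :: nat where m: "m > 0" "1 / m < r"
    using nat_approx_posE[OF r(1)] by (metis zero_less_Suc)
  have "norm (c (Suc j / m) - c (j / m)) < \<delta>" if "j < m" for j
  proof -
    have "dist (Suc j / m) (j / m) < r"
      using m by (simp add: dist_real_def field_simps)
    then show ?thesis
      using r(2)[of "j / m" "Suc j / m"] that m(1) by (simp add: dist_norm)
  qed
  moreover have "(\<Sum>j<m. N (c (Suc j / m) - c (j / m))) \<le> N (x - 0) + e"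
    using m(1) by (intro c(4)[rule_format, of "\<lambda>j. real j / m"]) (auto simp: divide_right_mono)
  ultimately show ?thesis
    using c m(1) by (intro exI[of _ m] exI[of _ "\<lambda>j. c (real j / m)"]) auto
qed

lemma is_norm_N: "is_norm N"
proof -
  obtain c where c: "0 < c" "\<And>x. c * norm x \<le> N x" using N_lower by blast
  have "0 < 1 + (\<Sum>i\<in>UNIV. N (axis i 1))"
    using sum_nonneg[of UNIV "\<lambda>i. N (axis i 1)"] N_nonneg by force
  then show ?thesis
    using is_norm_if_short_chains[OF c _ N_upper N_sub N_minus N_short_chain] by blast
qed

end

theorem theorem4:
  fixes \<Phi> :: "real ^ 'n \<Rightarrow> real"
  assumes nonneg: "\<And>x. x \<in> nonneg_orthant \<Longrightarrow> 0 \<le> \<Phi> x"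
    and large: "\<exists>f :: real \<Rightarrow> 'a. inj f"
  shows "(\<forall>(X :: 'n \<Rightarrow> 'a set) (d :: 'n \<Rightarrow> 'a \<Rightarrow> 'a \<Rightarrow> real).
            (\<forall>i. inner_metric_space (X i) (d i)) \<longrightarrow>
            inner_metric_space (\<Pi>\<^sub>E i\<in>UNIV. X i) (product_dist \<Phi> d))
         \<longleftrightarrow> is_norm (even_extension \<Phi>)"
proof
  assume H: "\<forall>(X :: 'n \<Rightarrow> 'a set) (d :: 'n \<Rightarrow> 'a \<Rightarrow> 'a \<Rightarrow> real).
      (\<forall>i. inner_metric_space (X i) (d i)) \<longrightarrow>
      inner_metric_space (\<Pi>\<^sub>E i\<in>UNIV. X i) (product_dist \<Phi> d)"
  obtain f :: "real \<Rightarrow> 'a" where "inj f" using large by blast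
  then interpret inner_preserving \<Phi> f
    using H by unfold_locales auto
  show "is_norm (even_extension \<Phi>)" by (rule is_norm_N)
qed (blast intro: inner_metric_space_product)

end
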